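(* Let $d$, $n$, $k$, $s$ be positive integers with $d\mid n$ and let $\zeta\in\mathbb{C}$ be a primitive $d$-th root of unity. Let $T$ be an endofunction on $[n]=\{1,\dots,n\}$ with one connected component, consisting of a cycle having $ds$ nodes and $k$ trees attached to the nodes of the cycle, such that each attached tree has a $d$-splitting subset. Then $$\sigma(d;T)=g_T(\zeta,\zeta^2,\dots,\zeta^d).$$
   Context: A connected endofunction $T$ of a finite set (one whose functional graph with edges $x\to T(x)$ is connected) has exactly one cycle. For each node $v$ not on the cycle with $T(v)$ on the cycle, the tree attached to the cycle with root $v$ consists of all nodes $x$ with $T^i(x)=v$ for some $i\ge0$; it does not include the cycle node $T(v)$. Any rooted tree (edges pointing to the root) is regarded as an endofunction of its node set by sending each non-root node along its outgoing edge and the root to itself. For an endofunction $S$ on a finite set $X$ of size $M$, a subset $W\subseteq X$ is $d$-splitting if $d\mid M$, $|W|=M/d$ and $W\cup SW\cup\cdots\cup S^{d-1}W=X$; $\sigma(d;S)$ is the number of $d$-splitting subsets. A tree has a $d$-splitting subset if the associated endofunction does. A subset $U$ is $T$-invariant if $TU\subseteq U$. A $d$-flag of $T$-invariant subsets of $[n]$ is a sequence $\emptyset=U_0\subseteq U_1\subseteq\cdots\subseteq U_{d-1}\subseteq U_d=[n]$ with every $U_i$ $T$-invariant. The generating function of $d$-flags is $g_T(t_1,\dots,t_d)=\sum_J a_J\,t_1^{j_1}\cdots t_d^{j_d}$, the sum over $d$-tuples $J=(j_1,\dots,j_d)$ of non-negative integers, where $a_J$ is the number of $d$-flags with $|U_i|=j_1+\cdots+j_i$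 for all $1\le i\le d$. *)

theory Defs
  imports Complex_Main "HOL-Library.FuncSet"
begin

text \<open>
  An endofunction of a set \<open>X\<close> is a function \<open>T\<close> on the ambient type with \<open>T \<in> X \<rightarrow> X\<close>;
  all notions below depend only on the values of \<open>T\<close> on \<open>X\<close>.
\<close>

definition primitive_root_of_unity :: "nat \<Rightarrow> complex \<Rightarrow> bool" where
  "primitive_root_of_unity d z \<longleftrightarrow> d > 0 \<and> z ^ d = 1 \<and> (\<forall>m. 0 < m \<and> m < d \<longrightarrow> z ^ m \<noteq> 1)"

subsection \<open>Functional graphs\<close>

definition functional_graph :: "'a set \<Rightarrow> ('a \<Rightarrow> 'a) \<Rightarrow> ('a \<times> 'a) set" where
  "functional_graph X T = {(x, T x) | x. x \<in> X}"

text \<open>Connectedness is that of the underlying undirected graph.\<close>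

definition connected_endo :: "'a set \<Rightarrow> ('a \<Rightarrow> 'a) \<Rightarrow> bool" where
  "connected_endo X T \<longleftrightarrow> X \<noteq> {} \<and>
     (\<forall>x\<in>X. \<forall>y\<in>X. (x, y) \<in> (functional_graph X T \<union> (functional_graph X T)\<inverse>)\<^sup>*)"

text \<open>The nodes lying on cycles; for connected \<open>T\<close> on finite \<open>X\<close>, the nodes of the unique cycle.\<close>

definition cycle_nodes :: "'a set \<Rightarrow> ('a \<Rightarrow> 'a) \<Rightarrow> 'a set" where
  "cycle_nodes X T = {x \<in> X. \<exists>i>0. (T ^^ i) x = x}"

definition attached_roots :: "'a set \<Rightarrow> ('a \<Rightarrow> 'a) \<Rightarrow> 'a set" where
  "attached_roots X T = {v \<in> X. v \<notin> cycle_nodes X T \<and> T v \<in> cycle_nodes X T}"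

definition tree_nodes :: "'a set \<Rightarrow> ('a \<Rightarrow> 'a) \<Rightarrow> 'a \<Rightarrow> 'a set" where
  "tree_nodes X T v = {x \<in> X. \<exists>i. (T ^^ i) x = v}"

text \<open>The endofunction of \<open>tree_nodes X T v\<close> associated to the tree with root \<open>v\<close>.\<close>

definition tree_endo :: "('a \<Rightarrow> 'a) \<Rightarrow> 'a \<Rightarrow> 'a \<Rightarrow> 'a" where
  "tree_endo T v = T(v := v)"

subsection \<open>Splitting subsets\<close>

definition splitting_subset :: "nat \<Rightarrow> 'a set \<Rightarrow> ('a \<Rightarrow> 'a) \<Rightarrow> 'a set \<Rightarrow> bool" where
  "splitting_subset d X S W \<longleftrightarrow>
     d dvd card X \<and> W \<subseteq> X \<and> card W = card X div d \<and> (\<Union>i<d. (S ^^ i) ` W) = X"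

definition num_splitting :: "nat \<Rightarrow> 'a set \<Rightarrow> ('a \<Rightarrow> 'a) \<Rightarrow> nat" where
  "num_splitting d X S = card {W. splitting_subset d X S W}"

subsection \<open>Flags of invariant subsets\<close>

definition invariant_subset :: "'a set \<Rightarrow> ('a \<Rightarrow> 'a) \<Rightarrow> 'a set \<Rightarrow> bool" where
  "invariant_subset X T U \<longleftrightarrow> U \<subseteq> X \<and> T ` U \<subseteq> U"

text \<open>
  Sequences and tuples are extensional functions on their index sets, so that distinct functions
  are distinct sequences and counting is meaningful.
\<close>

definition invariant_flags :: "nat \<Rightarrow> 'a set \<Rightarrow> ('a \<Rightarrow> 'a) \<Rightarrow> (nat \<Rightarrow> 'a set) set" where
  "invariant_flags d X T =
     {U \<in> {0..d} \<rightarrow>\<^sub>E {A. invariant_subset X T A}.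
        U 0 = {} \<and> U d = X \<and> (\<forall>i<d. U i \<subseteq> U (Suc i))}"

definition flag_count :: "nat \<Rightarrow> 'a set \<Rightarrow> ('a \<Rightarrow> 'a) \<Rightarrow> (nat \<Rightarrow> nat) \<Rightarrow> nat" where
  "flag_count d X T J =
     card {U \<in> invariant_flags d X T. \<forall>i\<in>{1..d}. card (U i) = (\<Sum>l=1..i. J l)}"

text \<open>
  The value of the generating function at \<open>(t 1, \<dots>, t d)\<close>. The sum runs over all \<open>d\<close>-tuples with
  non-zero coefficient; there are only finitely many of them by \<open>finite_flag_support\<close>.
\<close>

definition flag_support :: "nat \<Rightarrow> 'a set \<Rightarrow> ('a \<Rightarrow> 'a) \<Rightarrow> (nat \<Rightarrow> nat) set" where
  "flag_support d X T = {J \<in> {1..d} \<rightarrow>\<^sub>E UNIV. flag_count d X T J \<noteq> 0}"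

definition flag_gf :: "nat \<Rightarrow> 'a set \<Rightarrow> ('a \<Rightarrow> 'a) \<Rightarrow> (nat \<Rightarrow> 'b::comm_semiring_1) \<Rightarrow> 'b" where
  "flag_gf d X T t =
     (\<Sum>J\<in>flag_support d X T. of_nat (flag_count d X T J) * (\<Prod>i=1..d. t i ^ J i))"

lemma finite_flag_support: "finite (flag_support d X T)"
proof (rule finite_subset)
  show "flag_support d X T \<subseteq> {1..d} \<rightarrow>\<^sub>E {0..card X}"
  proof
    fix J assume "J \<in> flag_support d X T"
    then have J: "J \<in> {1..d} \<rightarrow>\<^sub>E UNIV" and "flag_count d X T J \<noteq> 0"
      by (auto simp: flag_support_def)
    then have "{U \<in> invariant_flags d X T. \<forall>i\<in>{1..d}. card (U i) = (\<Sum>l=1..i. J l)} \<noteq> {}"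
      unfolding flag_count_def by (metis card.empty)
    then obtain U where U: "U \<in> invariant_flags d X T"
        "\<forall>i\<in>{1..d}. card (U i) = (\<Sum>l=1..i. J l)" by blast
    have "J i \<le> card X" if i: "i \<in> {1..d}" for i
    proof -
      have "J i \<le> (\<Sum>l=1..d. J l)" using i by (intro member_le_sum) auto
      also have "\<dots> = card (U d)" using U(2) i by auto
      also have "U d = X" using U(1) by (simp add: invariant_flags_def)
      finally show ?thesis .
    qed
    with J show "J \<in> {1..d} \<rightarrow>\<^sub>E {0..card X}" by (auto simp: PiE_iff)
  qed
  show "finite ({1..d} \<rightarrow>\<^sub>E {0..card X})" by (intro finite_PiE) auto
qed

end

theory Submission
  imports Defs "HOL-Library.Disjoint_Sets"
begin

text \<open>
  Sending a node to the index of the first flag member containing it identifies flags with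
  labelings \<open>f : X \<rightarrow> {1..d}\<close> that satisfy \<open>f (T x) \<le> f x\<close>, weighted by the product of the
  \<open>\<zeta> ^ f x\<close>; and a splitting subset is the set of starting points of a partition of \<open>X\<close> into
  chains \<open>w, T w, \<dots>, T\<^sup>d\<^sup>-\<^sup>1 w\<close>. The splitting subsets of the trees partition the nodes off the cycle
  into such chains. A chain that starts as far as possible from the cycle is entered by no
  other chain, so it belongs to every partition, and removing it does not change the number of
  splitting subsets. Nor does it change the weighted number of labelings: extending a labeling
  over the chain contributes the complete homogeneous polynomial of degree \<open>d\<close> in
  \<open>\<zeta>\<^sup>c, \<dots>, \<zeta>\<^sup>d\<close>, where \<open>c\<close> is the label of the node the chain leads to, and this value is 1.
  In the end only the cycle is left. There the splitting subsets are \<open>d\<close> residue classes and the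
  labelings are the \<open>d\<close> constants, each of weight 1, so both counts equal \<open>d\<close>.
\<close>

section \<open>Labelings\<close>

text \<open>For \<open>T\<close> mapping \<open>Y\<close> into itself, the inequality says that all
  sublevel sets of \<open>f\<close> are invariant. Extensionality makes the set finite for finite
  \<open>Y\<close>, so it can be summed over.\<close>

definition labelings :: "nat \<Rightarrow> 'a set \<Rightarrow> ('a \<Rightarrow> 'a) \<Rightarrow> ('a \<Rightarrow> nat) set" where
  "labelings d Y T = {f \<in> Y \<rightarrow>\<^sub>E {1..d}. \<forall>x\<in>Y. f (T x) \<le> f x}"

text \<open>The factor \<open>\<phi> (f y)\<close> stores what nodes already removed contribute, as
  a function of the label of the node \<open>y\<close> that they led to.\<close>

definition labeling_sum ::
    "nat \<Rightarrow> 'a set \<Rightarrow> ('a \<Rightarrow> 'a) \<Rightarrow> (nat \<Rightarrow> 'b::comm_semiring_1) \<Rightarrow> (nat \<Rightarrow> 'b) \<Rightarrow> 'a \<Rightarrow> 'b" where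
  "labeling_sum d Y T t \<phi> y = (\<Sum>f\<in>labelings d Y T. (\<Prod>x\<in>Y. t (f x)) * \<phi> (f y))"

lemma finite_labelings: "finite Y \<Longrightarrow> finite (labelings d Y T)"
  unfolding labelings_def by (rule finite_subset[of _ "Y \<rightarrow>\<^sub>E {1..d}"]) (auto intro: finite_PiE)

text \<open>Nestedness makes membership of \<open>x\<close> in \<open>U i\<close> a threshold
  condition on \<open>i\<close>, so the least such index determines the flag at \<open>x\<close>.
  The end conditions \<open>U 0 = {}\<close> and \<open>U d = X\<close> force this index into
  \<open>{1..d}\<close>, and invariance gives the inequality along \<open>T\<close>.\<close>

lemma bij_betw_flag_labeling:
  assumes T: "T \<in> X \<rightarrow> X"
  shows "bij_betw (\<lambda>f. \<lambda>i\<in>{0..d}. {x \<in> X. f x \<le> i}) (labelings d X T) (invariant_flags d X T)"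
proof (rule bij_betw_byWitness[where f' = "\<lambda>U. \<lambda>x\<in>X. LEAST i. x \<in> U i"])
  show "\<forall>f\<in>labelings d X T.
      (\<lambda>x\<in>X. LEAST i. x \<in> (\<lambda>i\<in>{0..d}. {x \<in> X. f x \<le> i}) i) = f"
  proof
    fix f assume f: "f \<in> labelings d X T"
    show "(\<lambda>x\<in>X. LEAST i. x \<in> (\<lambda>i\<in>{0..d}. {x \<in> X. f x \<le> i}) i) = f"
    proof
      fix x
      show "(\<lambda>x\<in>X. LEAST i. x \<in> (\<lambda>i\<in>{0..d}. {x \<in> X. f x \<le> i}) i) x = f x"
      proof (cases "x \<in> X")
        case True
        then have fx: "f x \<le> d" using f by (auto simp: labelings_def PiE_iff)
        have "(LEAST i. x \<in> (\<lambda>i\<in>{0..d}. {x \<in> X. f x \<le> i}) i) = f x"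
        proof (rule Least_equality)
          show "x \<in> (\<lambda>i\<in>{0..d}. {x \<in> X. f x \<le> i}) (f x)" using True fx by auto
        next
          fix i assume i: "x \<in> (\<lambda>i\<in>{0..d}. {x \<in> X. f x \<le> i}) i"
          show "f x \<le> i"
            using i fx by (cases "i \<le> d") auto
        qed
        then show ?thesis using True by simp
      next
        case False
        then show ?thesis using f by (auto simp: labelings_def PiE_iff extensional_def)
      qed
    qed
  qed
next
  have mono: "U i \<subseteq> U j" if "U \<in> invariant_flags d X T" "i \<le> j" "j \<le> d" for U i j
    using that(2,3)
  proof (induction j rule: dec_induct)
    case (step m)
    have "U m \<subseteq> U (Suc m)" using that(1) step by (simp add: invariant_flags_def)
    with step show ?case by auto
  qed simp
  have le_iff: "x \<in> U i \<longleftrightarrow> (LEAST i. x \<in> U i) \<le> i"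
    if U: "U \<in> invariant_flags d X T" and "x \<in> X" "i \<le> d" for U x i
  proof
    assume "x \<in> U i" then show "(LEAST i. x \<in> U i) \<le> i" by (rule Least_le)
  next
    assume le: "(LEAST i. x \<in> U i) \<le> i"
    have "x \<in> U d" using U that by (simp add: invariant_flags_def)
    then have "x \<in> U (LEAST i. x \<in> U i)" by (rule LeastI)
    with mono[OF U le \<open>i \<le> d\<close>] show "x \<in> U i" by blast
  qed
  have sub: "U i \<subseteq> X" if "U \<in> invariant_flags d X T" "i \<le> d" for U i
    using that by (auto simp: invariant_flags_def invariant_subset_def PiE_iff Pi_iff)
  show "\<forall>U\<in>invariant_flags d X T.
      (\<lambda>i\<in>{0..d}. {x \<in> X. (\<lambda>x\<in>X. LEAST i. x \<in> U i) x \<le> i}) = U"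
  proof
    fix U assume U: "U \<in> invariant_flags d X T"
    show "(\<lambda>i\<in>{0..d}. {x \<in> X. (\<lambda>x\<in>X. LEAST i. x \<in> U i) x \<le> i}) = U"
    proof
      fix i
      show "(\<lambda>i\<in>{0..d}. {x \<in> X. (\<lambda>x\<in>X. LEAST i. x \<in> U i) x \<le> i}) i = U i"
      proof (cases "i \<le> d")
        case True
        then show ?thesis using le_iff[OF U _ True] sub[OF U True] by auto
      next
        case False
        then show ?thesis using U by (auto simp: invariant_flags_def PiE_iff extensional_def)
      qed
    qed
  qed
  show "(\<lambda>f. \<lambda>i\<in>{0..d}. {x \<in> X. f x \<le> i}) ` labelings d X T \<subseteq> invariant_flags d X T"
  proof
    fix U assume "U \<in> (\<lambda>f. \<lambda>i\<in>{0..d}. {x \<in> X. f x \<le> i}) ` labelings d X T"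
    then obtain f where f: "f \<in> labelings d X T" and U: "U = (\<lambda>i\<in>{0..d}. {x \<in> X. f x \<le> i})"
      by auto
    have b: "1 \<le> f x" "f x \<le> d" "f (T x) \<le> f x" "T x \<in> X" if "x \<in> X" for x
      using that f T by (auto simp: labelings_def PiE_iff)
    show "U \<in> invariant_flags d X T"
      unfolding U invariant_flags_def invariant_subset_def
      using b by (fastforce intro: order_trans)
  qed
  show "(\<lambda>U. \<lambda>x\<in>X. LEAST i. x \<in> U i) ` invariant_flags d X T \<subseteq> labelings d X T"
  proof
    fix f assume "f \<in> (\<lambda>U. \<lambda>x\<in>X. LEAST i. x \<in> U i) ` invariant_flags d X T"
    then obtain U where U: "U \<in> invariant_flags d X T" and f: "f = (\<lambda>x\<in>X. LEAST i. x \<in> U i)"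
      by auto
    have iff: "x \<in> U i \<longleftrightarrow> f x \<le> i" if "x \<in> X" "i \<le> d" for x i
      using le_iff[OF U that] that f by simp
    have 0: "U 0 = {}" and d: "U d = X" using U by (auto simp: invariant_flags_def)
    have fx: "f x \<in> {1..d}" if "x \<in> X" for x
      using iff[OF that, of 0] iff[OF that, of d] 0 d that by auto
    have "f (T x) \<le> f x" if x: "x \<in> X" for x
    proof -
      have "x \<in> U (f x)" using iff[OF x] fx[OF x] by auto
      moreover have "T ` U (f x) \<subseteq> U (f x)"
        using U fx[OF x] by (auto simp: invariant_flags_def invariant_subset_def PiE_iff)
      ultimately have "T x \<in> U (f x)" by blast
      then show ?thesis using iff[of "T x" "f x"] fx[OF x] T x by auto
    qed
    with fx show "f \<in> labelings d X T" by (auto simp: labelings_def f)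
  qed
qed

text \<open>The differences of consecutive flag members are the fibres of the labeling. Hence the
  exponent of \<open>t i\<close> is the size of the fibre over \<open>i\<close>, and the monomial of
  a flag is a product over nodes. Grouping the labelings by their fibre sizes gives the generating
  function.\<close>

lemma flag_gf_eq_sum_labelings:
  assumes X: "finite X" and T: "T \<in> X \<rightarrow> X"
  shows "flag_gf d X T t = (\<Sum>f\<in>labelings d X T. \<Prod>x\<in>X. t (f x))"
proof -
  let ?U = "\<lambda>f. \<lambda>i\<in>{0..d}. {x \<in> X. f x \<le> i}"
  let ?J = "\<lambda>f. \<lambda>i\<in>{1..d}. card {x \<in> X. f x = i}"
  have card_le: "card {x \<in> X. f x \<le> i} = (\<Sum>l=1..i. card {x \<in> X. f x = l})"
    if "f \<in> labelings d X T" for f and i :: nat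
  proof -
    have "{x \<in> X. f x \<le> i} = (\<Union>l\<in>{1..i}. {x \<in> X. f x = l})"
      using that by (auto simp: labelings_def PiE_iff Pi_iff)
    then show ?thesis using X by (simp only:) (subst card_UN_disjoint; force)
  qed
  \<comment> \<open>\<open>flag_count\<close> prescribes partial sums of \<open>J\<close>, while
    fibre sizes match single entries; the two conditions are equivalent.\<close>
  have sums_eq: "(\<forall>i\<in>{1..d}. (\<Sum>l=1..i. A l) = (\<Sum>l=1..i. B l)) \<longleftrightarrow> (\<forall>i\<in>{1..d}. A i = B i)"
    for A B :: "nat \<Rightarrow> nat"
  proof (intro iffI ballI)
    fix i assume eq: "\<forall>i\<in>{1..d}. (\<Sum>l=1..i. A l) = (\<Sum>l=1..i. B l)" and i: "i \<in> {1..d}"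
    then obtain m where m: "i = Suc m" by (cases i) auto
    have "(\<Sum>l=1..m. A l) = (\<Sum>l=1..m. B l)" using eq i m by (cases "m = 0") auto
    with eq i m show "A i = B i" by force
  qed (auto intro: sum.cong)
  have count: "flag_count d X T J = card {f \<in> labelings d X T. ?J f = J}"
    if J: "J \<in> {1..d} \<rightarrow>\<^sub>E UNIV" for J
  proof -
    have "bij_betw ?U {f \<in> labelings d X T. ?J f = J}
        {U \<in> invariant_flags d X T. \<forall>i\<in>{1..d}. card (U i) = (\<Sum>l=1..i. J l)}"
    proof (rule bij_betw_Collect[OF bij_betw_flag_labeling[OF T]])
      fix f assume f: "f \<in> labelings d X T"
      have "(\<forall>i\<in>{1..d}. card (?U f i) = (\<Sum>l=1..i. J l)) \<longleftrightarrow>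
          (\<forall>i\<in>{1..d}. (\<Sum>l=1..i. card {x \<in> X. f x = l}) = (\<Sum>l=1..i. J l))"
        using card_le[OF f] by simp
      also have "\<dots> \<longleftrightarrow> (\<forall>i\<in>{1..d}. card {x \<in> X. f x = i} = J i)"
        by (rule sums_eq)
      also have "\<dots> \<longleftrightarrow> ?J f = J"
        using J by (auto simp: fun_eq_iff PiE_iff extensional_def)
      finally show "(\<forall>i\<in>{1..d}. card (?U f i) = (\<Sum>l=1..i. J l)) \<longleftrightarrow> ?J f = J" .
    qed
    from bij_betw_same_card[OF this] show ?thesis unfolding flag_count_def by (rule sym)
  qed
  have weight: "(\<Prod>i=1..d. t i ^ ?J f i) = (\<Prod>x\<in>X. t (f x))"
    if "f \<in> labelings d X T" for f
  proof -
    have "(\<Prod>x\<in>X. t (f x)) = (\<Prod>i\<in>{1..d}. \<Prod>x\<in>{x \<in> X. f x = i}. t (f x))"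
      using X that by (intro prod.group[symmetric]) (auto simp: labelings_def PiE_iff)
    then show ?thesis by simp
  qed
  have "flag_gf d X T t =
      (\<Sum>J\<in>flag_support d X T. \<Sum>f\<in>{f \<in> labelings d X T. ?J f = J}. \<Prod>x\<in>X. t (f x))"
    unfolding flag_gf_def
  proof (rule sum.cong[OF refl])
    fix J assume "J \<in> flag_support d X T"
    then have "flag_count d X T J = card {f \<in> labelings d X T. ?J f = J}"
      by (intro count) (simp add: flag_support_def)
    moreover have "(\<Sum>f\<in>{f \<in> labelings d X T. ?J f = J}. \<Prod>x\<in>X. t (f x)) =
        (\<Sum>f\<in>{f \<in> labelings d X T. ?J f = J}. \<Prod>i=1..d. t i ^ J i)"
      using weight by (intro sum.cong) auto
    ultimately show "of_nat (flag_count d X T J) * (\<Prod>i=1..d. t i ^ J i) =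
        (\<Sum>f\<in>{f \<in> labelings d X T. ?J f = J}. \<Prod>x\<in>X. t (f x))"
      by simp
  qed
  also have "\<dots> = (\<Sum>f\<in>labelings d X T. \<Prod>x\<in>X. t (f x))"
  proof (rule sum.group[OF finite_labelings[OF X] finite_flag_support])
    show "?J ` labelings d X T \<subseteq> flag_support d X T"
    proof
      fix J assume "J \<in> ?J ` labelings d X T"
      then obtain f where f: "f \<in> labelings d X T" and J: "J = ?J f" by auto
      have JE: "J \<in> {1..d} \<rightarrow>\<^sub>E UNIV" unfolding J by (auto simp: PiE_iff)
      have "f \<in> {f \<in> labelings d X T. ?J f = J}" using f J by simp
      then have "card {f \<in> labelings d X T. ?J f = J} \<noteq> 0"
        using finite_labelings[OF X, of d T] by (subst card_0_eq) (simp, blast)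
      then show "J \<in> flag_support d X T" using JE count[OF JE] by (simp add: flag_support_def)
    qed
  qed
  finally show ?thesis .
qed

text \<open>Nothing in \<open>Y\<close> maps to \<open>y\<close>, so the label \<open>a\<close> of
  \<open>y\<close> is only bounded below, by the label \<open>c\<close> of \<open>T y\<close>.
  Summing over \<open>a\<close> first leaves a weight that depends on \<open>c\<close>
  alone.\<close>

lemma labeling_sum_remove_leaf:
  assumes "finite Y" and y: "y \<in> Y" and T: "T \<in> Y \<rightarrow> Y - {y}"
  shows "labeling_sum d Y T t \<phi> y =
    labeling_sum d (Y - {y}) T t (\<lambda>c. \<Sum>a=c..d. t a * \<phi> a) (T y)"
proof -
  let ?L = "labelings d (Y - {y}) T"
  have "labeling_sum d (Y - {y}) T t (\<lambda>c. \<Sum>a=c..d. t a * \<phi> a) (T y) =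
      (\<Sum>g\<in>?L. \<Sum>a=g (T y)..d. (\<Prod>x\<in>Y - {y}. t (g x)) * (t a * \<phi> a))"
    by (simp add: labeling_sum_def sum_distrib_left)
  also have "\<dots> = (\<Sum>(g, a)\<in>(SIGMA g:?L. {g (T y)..d}).
      (\<Prod>x\<in>Y - {y}. t (g x)) * (t a * \<phi> a))"
    using assms by (intro sum.Sigma) (auto simp: finite_labelings)
  also have "\<dots> = labeling_sum d Y T t \<phi> y"
    unfolding labeling_sum_def
  proof (rule sum.reindex_bij_witness[where j = "\<lambda>(g, a). g(y := a)"
        and i = "\<lambda>f. (restrict f (Y - {y}), f y)"], goal_cases)
    case (1 p)
    then show ?case by (auto simp: labelings_def PiE_iff extensional_def fun_eq_iff)
  next
    case (2 p)
    obtain g a where p: "p = (g, a)" by force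
    have g: "g \<in> ?L" and a: "g (T y) \<le> a" "a \<le> d" using 2 p by auto
    \<comment> \<open>The new label is at least 1 because it is bounded below by the label of
      \<open>T y\<close>, which is still in the labeled set.\<close>
    have "T y \<in> Y - {y}" using T y by auto
    with g have "1 \<le> g (T y)" by (auto simp: labelings_def PiE_iff)
    with g a have "a \<in> {1..d}" by auto
    with g a p y T show ?case
      by (auto simp: labelings_def PiE_iff extensional_def Pi_iff)
  next
    case (3 f)
    then show ?case using y by (auto simp: labelings_def PiE_iff extensional_def fun_eq_iff)
  next
    case (4 f)
    then show ?case using y T by (auto simp: labelings_def PiE_iff Pi_iff)
  next
    case (5 p)
    obtain g a where p: "p = (g, a)" by force
    have "(\<Prod>x\<in>Y. t ((g(y := a)) x)) = t a * (\<Prod>x\<in>Y - {y}. t ((g(y := a)) x))"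
      using assms by (subst prod.remove[of Y y]) auto
    also have "(\<Prod>x\<in>Y - {y}. t ((g(y := a)) x)) = (\<Prod>x\<in>Y - {y}. t (g x))"
      by (intro prod.cong) auto
    finally show ?case by (simp add: p mult_ac)
  qed
  finally show ?thesis by simp
qed

section \<open>Complete homogeneous sums at a root of unity\<close>

text \<open>The complete homogeneous symmetric polynomial of degree \<open>r\<close> in \<open>t c, \<dots>, t d\<close>.\<close>

fun hom_sum :: "(nat \<Rightarrow> 'b::comm_semiring_1) \<Rightarrow> nat \<Rightarrow> nat \<Rightarrow> nat \<Rightarrow> 'b" where
  "hom_sum t d 0 c = 1"
| "hom_sum t d (Suc r) c = (\<Sum>a=c..d. t a * hom_sum t d r a)"

text \<open>This is the \<open>q\<close>-binomial formula for \<open>h\<^sub>r\<close>, with the denominator cleared.\<close>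

lemma hom_sum_powers_mult:
  fixes z :: "'b::comm_ring_1"
  assumes z: "z ^ d = 1" and "c \<le> Suc d"
  shows "hom_sum (\<lambda>i. z ^ i) d r c * (\<Prod>j<r. 1 - z ^ Suc j) = (\<Prod>j<r. z ^ c - z ^ Suc j)"
  using assms(2)
proof (induction r arbitrary: c)
  case (Suc r)
  note IH = Suc.IH
  show ?case using Suc.prems
  proof (induction c rule: inc_induct)
    \<comment> \<open>At \<open>Suc d\<close> the sum is empty, and the factor for
      \<open>j = 0\<close> on the right is \<open>z ^ Suc d - z = 0\<close>.\<close>
    case base
    have "\<exists>j\<in>{..<Suc r}. z ^ Suc d - z ^ Suc j = 0" using z by (intro bexI[of _ 0]) auto
    then have "(\<Prod>j<Suc r. z ^ Suc d - z ^ Suc j) = 0" by (intro prod_zero) auto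
    then show ?case by simp
  next
    case (step c)
    let ?D = "\<Prod>j<r. 1 - z ^ Suc j" and ?P = "\<Prod>j<r. z ^ c - z ^ Suc j"
    \<comment> \<open>Shifting \<open>c\<close> by one: pull \<open>z\<close> out of every factor
      and split off the factor for \<open>j = 0\<close>.\<close>
    have "(\<Prod>j<Suc r. z ^ Suc c - z ^ Suc j) = (\<Prod>j<Suc r. z * (z ^ c - z ^ j))"
      by (simp add: algebra_simps)
    also have "\<dots> = z ^ Suc r * (\<Prod>j<Suc r. z ^ c - z ^ j)"
      by (simp add: prod.distrib del: prod.lessThan_Suc)
    also have "(\<Prod>j<Suc r. z ^ c - z ^ j) = (z ^ c - 1) * ?P"
      by (simp add: prod.lessThan_Suc_shift del: prod.lessThan_Suc)
    finally have P: "(\<Prod>j<Suc r. z ^ Suc c - z ^ Suc j) = z ^ Suc r * ((z ^ c - 1) * ?P)" .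
    \<comment> \<open>Monomials either contain the lowest variable \<open>z ^ c\<close> or use only
      the variables from \<open>Suc c\<close> on.\<close>
    have "hom_sum (\<lambda>i. z ^ i) d (Suc r) c * (\<Prod>j<Suc r. 1 - z ^ Suc j) =
        z ^ c * (1 - z ^ Suc r) * (hom_sum (\<lambda>i. z ^ i) d r c * ?D) +
        hom_sum (\<lambda>i. z ^ i) d (Suc r) (Suc c) * (\<Prod>j<Suc r. 1 - z ^ Suc j)"
      using step.hyps by (simp add: sum.atLeast_Suc_atMost algebra_simps)
    also have "\<dots> = z ^ c * (1 - z ^ Suc r) * ?P + z ^ Suc r * ((z ^ c - 1) * ?P)"
      using step.hyps IH[of c] step.IH P by simp
    also have "\<dots> = ?P * (z ^ c - z ^ Suc r)" by (simp add: algebra_simps)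
    finally show ?case by simp
  qed
qed simp

text \<open>The product formula is useless in degree \<open>d\<close>, since its denominator
  contains \<open>1 - z ^ d = 0\<close>. Therefore one variable is split off and the formula is
  applied in degree \<open>d - 1\<close>, where primitivity keeps the denominator nonzero. There the
  numerator vanishes for all \<open>a < d\<close>, and only \<open>a = d\<close> survives,
  contributing 1.\<close>

lemma hom_sum_primitive_root:
  assumes z: "primitive_root_of_unity d z" and c: "1 \<le> c" "c \<le> d"
  shows "hom_sum (\<lambda>i. z ^ i) d d c = 1"
proof -
  obtain m where m: "d = Suc m" using c by (cases d) auto
  have zd: "z ^ d = 1" using z by (simp add: primitive_root_of_unity_def)
  let ?D = "\<Prod>j<m. 1 - z ^ Suc j"
  have "z ^ Suc j \<noteq> 1" if "j < m" for j
    using z that m unfolding primitive_root_of_unity_def by (metis Suc_less_eq zero_less_Suc)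
  then have D: "?D \<noteq> 0" by (force simp: prod_zero_iff)
  have 0: "hom_sum (\<lambda>i. z ^ i) d m a = 0" if a: "a \<in> {c..<d}" for a
  proof -
    have "\<exists>j\<in>{..<m}. z ^ a - z ^ Suc j = 0"
      using a c m by (intro bexI[of _ "a - 1"]) auto
    then have "(\<Prod>j<m. z ^ a - z ^ Suc j) = 0" by (intro prod_zero) auto
    then have "hom_sum (\<lambda>i. z ^ i) d m a * ?D = 0"
      using hom_sum_powers_mult[OF zd, of a m] a by simp
    with D show ?thesis by (simp only: mult_eq_0_iff simp_thms)
  qed
  have 1: "hom_sum (\<lambda>i. z ^ i) d m d = 1"
  proof -
    have "hom_sum (\<lambda>i. z ^ i) d m d * ?D = 1 * ?D"
      using hom_sum_powers_mult[OF zd, of d m] zd by simp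
    with D show ?thesis by (simp only: mult_cancel_right simp_thms)
  qed
  have "hom_sum (\<lambda>i. z ^ i) d d c = (\<Sum>a=c..d. z ^ a * hom_sum (\<lambda>i. z ^ i) d m a)"
    using m by simp
  also have "{c..d} = insert d {c..<d}" using c by auto
  also have "(\<Sum>a\<in>insert d {c..<d}. z ^ a * hom_sum (\<lambda>i. z ^ i) d m a) = 1"
    using 0 1 zd by simp
  finally show ?thesis .
qed

section \<open>Removing a chain\<close>

definition chain :: "nat \<Rightarrow> ('a \<Rightarrow> 'a) \<Rightarrow> 'a \<Rightarrow> 'a set" where
  "chain r T w = (\<lambda>i. (T ^^ i) w) ` {..<r}"

text \<open>The last condition serves twice: no node outside the chain enters it, and
  \<open>T\<close> restricts to an endofunction of what remains.\<close>

definition removable_chain :: "nat \<Rightarrow> 'a set \<Rightarrow> ('a \<Rightarrow> 'a) \<Rightarrow> 'a \<Rightarrow> bool" where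
  "removable_chain d Y T w \<longleftrightarrow> w \<in> Y \<and> inj_on (\<lambda>i. (T ^^ i) w) {..<d} \<and>
     (T ^^ d) w \<notin> chain d T w \<and> T \<in> Y - chain d T w \<rightarrow> Y - chain d T w"

lemma funpow_in: "T \<in> Y \<rightarrow> Y \<Longrightarrow> x \<in> Y \<Longrightarrow> (T ^^ i) x \<in> Y"
  by (induction i) auto

text \<open>Nodes are removed from the start \<open>w\<close> onwards, each being a leaf when its
  turn comes. Starting from the weight 1, the successive leaf sums follow exactly the recursion of
  \<open>hom_sum\<close>.\<close>

lemma labeling_sum_remove_chain_prefix:
  assumes "finite Y" and T: "T \<in> Y \<rightarrow> Y" and w: "removable_chain d Y T w" and "r \<le> d"
  shows "labeling_sum d Y T t (\<lambda>_. 1) w =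
    labeling_sum d (Y - chain r T w) T t (hom_sum t d r) ((T ^^ r) w)"
  using \<open>r \<le> d\<close>
proof (induction r)
  case 0
  then show ?case by (simp add: chain_def labeling_sum_def)
next
  case (Suc r)
  let ?y = "(T ^^ r) w"
  have inj: "inj_on (\<lambda>i. (T ^^ i) w) {..<d}" and end_notin: "(T ^^ d) w \<notin> chain d T w"
    and inv: "T \<in> Y - chain d T w \<rightarrow> Y - chain d T w" and wY: "w \<in> Y"
    using w by (auto simp: removable_chain_def)
  have Suc_chain: "chain (Suc r) T w = insert ?y (chain r T w)"
    by (auto simp: chain_def lessThan_Suc)
  have y_in: "?y \<in> Y - chain r T w"
    using funpow_in[OF T wY] Suc.prems inj_onD[OF inj, of r] by (force simp: chain_def)
  \<comment> \<open>The current node has no preimage left: a remaining chain node maps to a later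
    chain node or to the exit \<open>(T ^^ d) w\<close>, and a node off the chain never enters
    it.\<close>
  have "T x \<in> Y - chain (Suc r) T w" if x: "x \<in> Y - chain r T w" for x
  proof (cases "x \<in> chain d T w")
    case True
    then obtain j where j: "j < d" "x = (T ^^ j) w" by (auto simp: chain_def)
    have rj: "r \<le> j" using x j by (force simp: chain_def)
    have "T x \<notin> chain (Suc r) T w"
    proof
      assume "T x \<in> chain (Suc r) T w"
      then obtain i where i: "i \<le> r" "(T ^^ Suc j) w = (T ^^ i) w"
        using j by (auto simp: chain_def less_Suc_eq_le)
      show False
      proof (cases "Suc j < d")
        case True
        then show False using inj_onD[OF inj i(2)] i(1) rj by auto
      next
        case False
        then have "Suc j = d" using j by auto
        then show False using end_notin i Suc.prems
          by (force simp: chain_def)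
      qed
    qed
    then show ?thesis using x T by auto
  next
    case False
    then have "T x \<in> Y - chain d T w" using inv x by auto
    moreover have "chain (Suc r) T w \<subseteq> chain d T w" using Suc.prems by (auto simp: chain_def)
    ultimately show ?thesis by auto
  qed
  then have "T \<in> Y - chain r T w \<rightarrow> Y - chain r T w - {?y}" by (auto simp: Suc_chain)
  moreover have "(\<lambda>c. \<Sum>a=c..d. t a * hom_sum t d r a) = hom_sum t d (Suc r)" by auto
  ultimately
  have "labeling_sum d (Y - chain r T w) T t (hom_sum t d r) ?y =
      labeling_sum d (Y - chain r T w - {?y}) T t (hom_sum t d (Suc r)) (T ?y)"
    using labeling_sum_remove_leaf[OF _ y_in, of T d t "hom_sum t d r"] \<open>finite Y\<close> by simp
  moreover have "Y - chain r T w - {?y} = Y - chain (Suc r) T w" by (auto simp: Suc_chain)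
  ultimately show ?case using Suc by (simp del: hom_sum.simps)
qed

text \<open>The exit \<open>(T ^^ d) w\<close> stays in the remaining set, so its label lies in
  \<open>{1..d}\<close> and the weight collected by the chain is 1 whatever that label is.\<close>

lemma labelings_weight_remove_chain:
  assumes z: "primitive_root_of_unity d z"
    and Y: "finite Y" "T \<in> Y \<rightarrow> Y" and w: "removable_chain d Y T w"
  shows "(\<Sum>f\<in>labelings d Y T. \<Prod>x\<in>Y. z ^ f x) =
    (\<Sum>f\<in>labelings d (Y - chain d T w) T. \<Prod>x\<in>Y - chain d T w. z ^ f x)"
proof -
  have "(T ^^ d) w \<in> Y - chain d T w"
    using w funpow_in[OF Y(2), of w d] by (auto simp: removable_chain_def)
  then have "hom_sum (\<lambda>i. z ^ i) d d (f ((T ^^ d) w)) = 1"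
    if "f \<in> labelings d (Y - chain d T w) T" for f
    using that by (intro hom_sum_primitive_root[OF z]) (auto simp: labelings_def PiE_iff)
  then show ?thesis
    using labeling_sum_remove_chain_prefix[OF Y w order_refl, of "\<lambda>i. z ^ i"]
    by (simp add: labeling_sum_def)
qed

section \<open>Splitting subsets as partitions into chains\<close>

text \<open>The bijection expresses covering, disjointness and chain length at once. It involves
  only iterates below \<open>d\<close>, so the notion makes sense on sets that \<open>T\<close>
  leaves, such as the complement of the cycle.\<close>

definition chain_partition :: "nat \<Rightarrow> ('a \<Rightarrow> 'a) \<Rightarrow> 'a set \<Rightarrow> 'a set \<Rightarrow> bool" where
  "chain_partition d T W Y \<longleftrightarrow> bij_betw (\<lambda>(i, w). (T ^^ i) w) ({..<d} \<times> W) Y"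

lemma chain_partition_in:
  "chain_partition d T W Y \<Longrightarrow> i < d \<Longrightarrow> w \<in> W \<Longrightarrow> (T ^^ i) w \<in> Y"
  unfolding chain_partition_def by (drule bij_betwE) force

lemma chain_partition_eqD:
  assumes "chain_partition d T W Y" "(T ^^ i) w = (T ^^ j) u" "i < d" "j < d" "w \<in> W" "u \<in> W"
  shows "i = j \<and> w = u"
proof -
  have "inj_on (\<lambda>(i, w). (T ^^ i) w) ({..<d} \<times> W)"
    using assms(1) by (simp add: chain_partition_def bij_betw_def)
  from inj_onD[OF this, of "(i, w)" "(j, u)"] assms show ?thesis by simp
qed

lemma chain_partition_obtain:
  assumes "chain_partition d T W Y" "x \<in> Y"
  obtains i w where "i < d" "w \<in> W" "x = (T ^^ i) w"
proof -
  have "x \<in> (\<lambda>(i, w). (T ^^ i) w) ` ({..<d} \<times> W)"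
    using assms by (simp add: chain_partition_def bij_betw_def)
  with that show thesis by auto
qed

lemma chain_partition_subset: "chain_partition d T W Y \<Longrightarrow> d > 0 \<Longrightarrow> W \<subseteq> Y"
  using chain_partition_in[of d T W Y 0] by auto

text \<open>The cardinality condition makes the surjection from \<open>{..<d} \<times> W\<close>
  onto \<open>Y\<close> one between finite sets of equal size, hence injective.\<close>

lemma splitting_subset_iff_chain_partition:
  assumes d: "d > 0" and Y: "finite Y"
  shows "splitting_subset d Y T W \<longleftrightarrow> chain_partition d T W Y"
proof
  have image: "(\<lambda>(i, w). (T ^^ i) w) ` ({..<d} \<times> W) = (\<Union>i<d. (T ^^ i) ` W)" by force
  {
    assume s: "splitting_subset d Y T W"
    then have "finite W" and "card ({..<d} \<times> W) = card Y"
      using Y by (auto simp: splitting_subset_def finite_subset card_cartesian_product)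
    moreover have "(\<lambda>(i, w). (T ^^ i) w) ` ({..<d} \<times> W) = Y"
      unfolding image using s by (simp add: splitting_subset_def)
    ultimately show "chain_partition d T W Y"
      unfolding chain_partition_def bij_betw_def by (auto intro!: eq_card_imp_inj_on)
  next
    assume p: "chain_partition d T W Y"
    have "card Y = d * card W"
      using bij_betw_same_card[OF p[unfolded chain_partition_def]]
      by (simp add: card_cartesian_product)
    moreover have "(\<Union>i<d. (T ^^ i) ` W) = Y"
      using p unfolding chain_partition_def bij_betw_def image by simp
    ultimately show "splitting_subset d Y T W"
      using d chain_partition_subset[OF p d] by (simp add: splitting_subset_def)
  }
qed

lemma chain_partition_remove:
  assumes p: "chain_partition d T W Y" and w: "w \<in> W"
  shows "chain_partition d T (W - {w}) (Y - chain d T w)"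
  unfolding chain_partition_def
proof (rule bij_betw_subset[OF p[unfolded chain_partition_def]])
  have "(\<lambda>(i, w). (T ^^ i) w) ` ({..<d} \<times> W - {..<d} \<times> {w}) =
      (\<lambda>(i, w). (T ^^ i) w) ` ({..<d} \<times> W) - (\<lambda>(i, w). (T ^^ i) w) ` ({..<d} \<times> {w})"
    using p w
    by (intro inj_on_image_set_diff[where C = "{..<d} \<times> W"])
      (auto simp: chain_partition_def bij_betw_def)
  also have "(\<lambda>(i, w). (T ^^ i) w) ` ({..<d} \<times> W) = Y"
    using p by (simp add: chain_partition_def bij_betw_def)
  also have "(\<lambda>(i, w). (T ^^ i) w) ` ({..<d} \<times> {w}) = chain d T w"
    by (force simp: chain_def)
  also have "{..<d} \<times> W - {..<d} \<times> {w} = {..<d} \<times> (W - {w})" by auto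
  finally show "(\<lambda>(i, w). (T ^^ i) w) ` ({..<d} \<times> (W - {w})) = Y - chain d T w" .
qed auto

lemma chain_partition_insert:
  assumes p: "chain_partition d T W (Y - chain d T w)" and sub: "chain d T w \<subseteq> Y"
    and inj: "inj_on (\<lambda>i. (T ^^ i) w) {..<d}"
  shows "chain_partition d T (insert w W) Y"
proof -
  have "bij_betw (\<lambda>(i, w). (T ^^ i) w) ({..<d} \<times> {w}) (chain d T w)"
    using inj by (force simp: bij_betw_def chain_def inj_on_def)
  from bij_betw_combine[OF this p[unfolded chain_partition_def]]
  have "bij_betw (\<lambda>(i, w). (T ^^ i) w) ({..<d} \<times> {w} \<union> {..<d} \<times> W)
      (chain d T w \<union> (Y - chain d T w))"
    by auto
  moreover have "{..<d} \<times> {w} \<union> {..<d} \<times> W = {..<d} \<times> insert w W" by auto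
  moreover have "chain d T w \<union> (Y - chain d T w) = Y" using sub by auto
  ultimately show ?thesis by (simp add: chain_partition_def)
qed

text \<open>Otherwise \<open>w\<close> has a predecessor in some chain of the partition. Nothing
  enters the removable chain from outside, so this predecessor lies on it and \<open>w\<close>
  returns to itself within \<open>d\<close> steps, which the distinctness of the nodes and the exit
  condition exclude.\<close>

lemma chain_start_in_partition:
  assumes p: "chain_partition d T W Y" and w: "removable_chain d Y T w" and d: "d > 0"
  shows "w \<in> W"
proof -
  have wC: "w \<in> chain d T w" using d by (force simp: chain_def)
  from w have "w \<in> Y" by (simp add: removable_chain_def)
  with p obtain i u where u: "i < d" "u \<in> W" "w = (T ^^ i) u" by (rule chain_partition_obtain)
  have "i = 0"
  proof (rule ccontr)
    assume "i \<noteq> 0"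
    then obtain m where m: "i = Suc m" by (cases i) auto
    let ?x = "(T ^^ m) u"
    have "?x \<in> Y" using chain_partition_in[OF p] u m by auto
    moreover have "T ?x = w" using u m by simp
    ultimately have "?x \<in> chain d T w"
      using w wC by (force simp: removable_chain_def)
    then obtain j where j: "j < d" "(T ^^ Suc j) w = w"
      using \<open>T ?x = w\<close> by (auto simp: chain_def)
    show False
    proof (cases "Suc j < d")
      case True
      then show False
        using w j inj_onD[of "\<lambda>i. (T ^^ i) w" "{..<d}" "Suc j" 0] d
        by (auto simp: removable_chain_def)
    next
      case False
      then have "(T ^^ d) w = w" using j by (metis Suc_lessI)
      then show False using w wC by (simp add: removable_chain_def)
    qed
  qed
  with u show ?thesis by simp
qed

text \<open>As \<open>w\<close> is forced to be a start, deleting and inserting \<open>w\<close> are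
  inverse to each other.\<close>

lemma num_splitting_remove_chain:
  assumes d: "d > 0" and Y: "finite Y" "T \<in> Y \<rightarrow> Y" and w: "removable_chain d Y T w"
  shows "num_splitting d Y T = num_splitting d (Y - chain d T w) T"
proof -
  have inj: "inj_on (\<lambda>i. (T ^^ i) w) {..<d}" and sub: "chain d T w \<subseteq> Y"
    using w funpow_in[OF Y(2)] by (auto simp: removable_chain_def chain_def)
  have "w \<in> chain d T w" using d by (force simp: chain_def)
  then have notin: "w \<notin> W" if "chain_partition d T W (Y - chain d T w)" for W
    using chain_partition_subset[OF that d] by blast
  have start: "w \<in> W" if "chain_partition d T W Y" for W
    using that w d by (rule chain_start_in_partition)
  have "bij_betw (\<lambda>W. W - {w}) {W. chain_partition d T W Y}
      {W. chain_partition d T W (Y - chain d T w)}"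
  proof (rule bij_betw_byWitness[where f' = "insert w"])
    show "\<forall>W\<in>{W. chain_partition d T W Y}. insert w (W - {w}) = W"
      using start by auto
    show "\<forall>W\<in>{W. chain_partition d T W (Y - chain d T w)}. insert w W - {w} = W"
      using notin by auto
    show "(\<lambda>W. W - {w}) ` {W. chain_partition d T W Y}
        \<subseteq> {W. chain_partition d T W (Y - chain d T w)}"
      using chain_partition_remove[OF _ start] by auto
    show "insert w ` {W. chain_partition d T W (Y - chain d T w)} \<subseteq> {W. chain_partition d T W Y}"
      using chain_partition_insert[OF _ sub inj] by auto
  qed
  from bij_betw_same_card[OF this] show ?thesis
    using Y d by (simp add: num_splitting_def splitting_subset_iff_chain_partition)
qed

text \<open>Both quantities are carried from \<open>Y\<close> down to \<open>K\<close>, one chain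
  per induction step. The function \<open>\<delta>\<close> acts as a height above \<open>K\<close>;
  a chain whose start has maximal height is removable.\<close>

lemma remove_chain_partition:
  assumes z: "primitive_root_of_unity d z"
    and "finite W" and "finite Y" and "T \<in> Y \<rightarrow> Y" and "K \<subseteq> Y" and "T \<in> K \<rightarrow> K"
    and "chain_partition d T W (Y - K)"
    and "\<And>x. x \<in> Y - K \<Longrightarrow> \<delta> x = Suc (\<delta> (T x))"
  shows "num_splitting d Y T = num_splitting d K T \<and>
    (\<Sum>f\<in>labelings d Y T. \<Prod>x\<in>Y. z ^ f x) = (\<Sum>f\<in>labelings d K T. \<Prod>x\<in>K. z ^ f x)"
  using assms(2-)
proof (induction "card W" arbitrary: W Y)
  case 0
  then have "Y = K" by (auto simp: chain_partition_def bij_betw_def)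
  then show ?case by simp
next
  case (Suc m)
  note p = \<open>chain_partition d T W (Y - K)\<close> and \<delta> = Suc.prems(7)
  have d: "d > 0" using z by (simp add: primitive_root_of_unity_def)
  have "W \<noteq> {}" using Suc.hyps by auto
  then obtain w where w: "w \<in> W" and max: "\<And>u. u \<in> W \<Longrightarrow> \<delta> u \<le> \<delta> w"
    using Max_in[of "\<delta> ` W"] Max_ge[of "\<delta> ` W"] \<open>finite W\<close> by fastforce
  let ?C = "chain d T w"
  have \<delta>_iter: "\<delta> u = i + \<delta> ((T ^^ i) u)" if "u \<in> W" "i \<le> d" for u i
    using that(2)
  proof (induction i)
    case (Suc i)
    then show ?case using \<delta>[OF chain_partition_in[OF p, of i u]] that(1) by simp
  qed simp
  have C: "?C \<subseteq> Y - K" using chain_partition_in[OF p _ w] by (auto simp: chain_def)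
  have inj: "inj_on (\<lambda>i. (T ^^ i) w) {..<d}"
    using chain_partition_eqD[OF p _ _ _ w w] by (auto simp: inj_on_def)
  \<comment> \<open>A common node would have height both \<open>\<delta> u - d\<close> and
    \<open>\<delta> w - j\<close> with \<open>j < d\<close>, making \<open>u\<close> higher than
    \<open>w\<close>. The case \<open>u = w\<close> is the exit condition of the chain
    itself.\<close>
  have end_notin: "(T ^^ d) u \<notin> ?C" if u: "u \<in> W" for u
  proof
    assume "(T ^^ d) u \<in> ?C"
    then obtain j where j: "j < d" "(T ^^ d) u = (T ^^ j) w" by (auto simp: chain_def)
    then show False using \<delta>_iter[OF u, of d] \<delta>_iter[OF w, of j] max[OF u] by simp
  qed
  \<comment> \<open>A remaining node lies in the closed set \<open>K\<close>, or its image is the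
    next node of a different chain, or it ends a chain and \<open>end_notin\<close> applies.\<close>
  have inv: "T \<in> Y - ?C \<rightarrow> Y - ?C"
  proof
    fix x assume x: "x \<in> Y - ?C"
    have "T x \<notin> ?C"
    proof (cases "x \<in> K")
      case True
      then show ?thesis using C \<open>T \<in> K \<rightarrow> K\<close> by auto
    next
      case False
      then have "x \<in> Y - K" using x by auto
      with p obtain i u where u: "i < d" "u \<in> W" "x = (T ^^ i) u"
        by (rule chain_partition_obtain)
      show ?thesis
      proof (cases "Suc i < d")
        case True
        have "u \<noteq> w" using x u by (auto simp: chain_def)
        then show ?thesis
          using chain_partition_eqD[OF p _ True _ u(2) w] u(3) by (auto simp: chain_def)
      next
        case False
        then have "T x = (T ^^ d) u" using u by (metis Suc_lessI comp_apply funpow.simps(2))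
        then show ?thesis using end_notin[OF u(2)] by simp
      qed
    qed
    then show "T x \<in> Y - ?C" using x \<open>T \<in> Y \<rightarrow> Y\<close> by auto
  qed
  have removable: "removable_chain d Y T w"
    unfolding removable_chain_def
    using chain_partition_subset[OF p d] w inj end_notin[OF w] inv by auto
  have "chain_partition d T (W - {w}) (Y - ?C - K)"
    using chain_partition_remove[OF p w] by (simp add: Diff_eq Int_ac)
  moreover have "m = card (W - {w})" using Suc.hyps(2) w \<open>finite W\<close> by simp
  ultimately have "num_splitting d (Y - ?C) T = num_splitting d K T \<and>
      (\<Sum>f\<in>labelings d (Y - ?C) T. \<Prod>x\<in>Y - ?C. z ^ f x) =
      (\<Sum>f\<in>labelings d K T. \<Prod>x\<in>K. z ^ f x)"
    using Suc.prems C inv \<delta> by (intro Suc.hyps(1)) auto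
  then show ?case
    using num_splitting_remove_chain[OF d _ _ removable]
      labelings_weight_remove_chain[OF z _ _ removable] Suc.prems by simp
qed


section \<open>The cycle\<close>

text \<open>On a cycle, consecutive chains must follow each other without gap, so a splitting subset
  is closed under advancing by \<open>d\<close>. It therefore contains a residue class modulo
  \<open>d\<close>, and a class already splits the cycle.\<close>

lemma num_splitting_cycle:
  assumes ds: "d > 0" "s > 0"
    and per: "\<And>i j. (T ^^ i) c = (T ^^ j) c \<longleftrightarrow> i mod (d * s) = j mod (d * s)"
  shows "num_splitting d (range (\<lambda>i. (T ^^ i) c)) T = d"
proof -
  let ?Y = "range (\<lambda>i. (T ^^ i) c)"
  \<comment> \<open>the residue classes modulo \<open>d\<close>, which are the splitting subsets\<close>
  define R where "R j = (\<lambda>i. (T ^^ i) c) ` {i. i mod d = j}" for j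
  have iter: "(T ^^ i) ((T ^^ j) c) = (T ^^ (i + j)) c" for i j by (simp add: funpow_add)
  have cong_d: "i mod d = j mod d" if "(T ^^ i) c = (T ^^ j) c" for i j
    using that per by (metis dvd_triv_left mod_mod_cancel)
  \<comment> \<open>Another \<open>d * s * k - k\<close> steps complete \<open>k\<close> to a
    multiple of the period, which undoes the \<open>k\<close> steps.\<close>
  have cancel: "(T ^^ i) c = (T ^^ j) c" if "(T ^^ (k + i)) c = (T ^^ (k + j)) c" for i j k
  proof -
    have "(T ^^ (d * s * k - k + (k + i))) c = (T ^^ (d * s * k - k + (k + j))) c"
      using that by (simp add: funpow_add)
    moreover have "d * s * k - k + (k + l) = d * s * k + l" for l using ds by simp
    ultimately show ?thesis by (simp add: per)
  qed
  have R_splits: "chain_partition d T (R j) ?Y" if "j < d" for j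
    unfolding chain_partition_def bij_betw_def
  proof
    show "inj_on (\<lambda>(i, w). (T ^^ i) w) ({..<d} \<times> R j)"
    proof (rule inj_onI, clarsimp simp: R_def iter)
      fix i a i' a'
      assume i: "i < d" "i' < d" and j: "j = a mod d" "a' mod d = a mod d"
        and eq: "(T ^^ (i + a)) c = (T ^^ (i' + a')) c"
      have "(i + a) mod d = (i' + a) mod d"
        using cong_d[OF eq] j by (metis mod_add_right_eq)
      then have "(i + a + (d * a - a)) mod d = (i' + a + (d * a - a)) mod d"
        by (metis mod_add_left_eq)
      moreover have "i + a + (d * a - a) = i + d * a" for i using \<open>d > 0\<close> by simp
      ultimately have "i = i'" using i by simp
      with eq cancel[of i a a'] show "i = i' \<and> (T ^^ a) c = (T ^^ a') c" by simp
    qed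
    show "(\<lambda>(i, w). (T ^^ i) w) ` ({..<d} \<times> R j) = ?Y"
    proof
      show "(\<lambda>(i, w). (T ^^ i) w) ` ({..<d} \<times> R j) \<subseteq> ?Y"
        by (auto simp: R_def iter)
      show "?Y \<subseteq> (\<lambda>(i, w). (T ^^ i) w) ` ({..<d} \<times> R j)"
      proof
        fix x assume "x \<in> ?Y"
        then obtain m where x: "x = (T ^^ m) c" by auto
        \<comment> \<open>Position \<open>m\<close> is reached in \<open>i\<close> steps from
          position \<open>a\<close> of class \<open>j\<close>. The summands \<open>d\<close> and
          \<open>d * s\<close> keep the natural subtractions exact without changing residues modulo
          \<open>d\<close>.\<close>
        define i where "i = (m + d - j) mod d"
        define a where "a = m + d * s - i"
        have "i < d" using ds by (simp add: i_def)
        also have "d \<le> d * s" using ds by simp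
        finally have ia: "i + a = m + d * s" by (simp add: a_def)
        then have "x = (T ^^ i) ((T ^^ a) c)" unfolding iter x by (simp add: per)
        moreover have "a mod d = j"
        proof -
          have "(m + d - j + a) mod d = (i + a) mod d" by (simp add: i_def mod_add_left_eq)
          also have "\<dots> = m mod d" unfolding ia by simp
          finally have "(m + d - j + a + j) mod d = (m + j) mod d" by (metis mod_add_left_eq)
          moreover have "m + d - j + a + j = m + d + a" using \<open>j < d\<close> by simp
          ultimately have "(m + a + d) mod d = (m + j) mod d" by (simp add: add_ac)
          then have "(m + a + (d * m - m)) mod d = (m + j + (d * m - m)) mod d"
            by (metis mod_add_left_eq mod_add_self2)
          moreover have "m + l + (d * m - m) = l + d * m" for l using \<open>d > 0\<close> by simp
          ultimately show ?thesis using \<open>j < d\<close> by simp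
        qed
        ultimately show "x \<in> (\<lambda>(i, w). (T ^^ i) w) ` ({..<d} \<times> R j)"
          using \<open>i < d\<close> by (force simp: R_def)
      qed
    qed
  qed
  have eq_R: "\<exists>j<d. W = R j" if p: "chain_partition d T W ?Y" for W
  proof -
    have W: "W \<subseteq> ?Y" by (rule chain_partition_subset[OF p ds(1)])
    have closed: "(T ^^ (i + d)) c \<in> W" if i: "(T ^^ i) c \<in> W" for i
    proof -
      obtain j w where j: "j < d" "w \<in> W" "(T ^^ (i + d)) c = (T ^^ j) w"
        by (rule chain_partition_obtain[OF p]) blast
      obtain k where k: "w = (T ^^ k) c" using W j by auto
      \<comment> \<open>If \<open>j > 0\<close>, stepping back once makes the last node of the chain
        from position \<open>i\<close> equal to node \<open>j - 1\<close> of the chain of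
        \<open>w\<close>. Uniqueness then gives \<open>j = d\<close>, contrary to
        \<open>j < d\<close>.\<close>
      have "j = 0"
      proof (rule ccontr)
        assume "j \<noteq> 0"
        then have "(T ^^ (1 + (d - 1 + i))) c = (T ^^ (1 + (j - 1 + k))) c"
          using j ds by (simp add: k iter add_ac flip: add_Suc_right)
        then have "(T ^^ (d - 1)) ((T ^^ i) c) = (T ^^ (j - 1)) w"
          unfolding k iter by (rule cancel)
        then have "d - 1 = j - 1"
          using chain_partition_eqD[OF p _ _ _ i j(2), of "d - 1" "j - 1"] j ds
          by (simp add: less_imp_diff_less)
        then show False using j \<open>j \<noteq> 0\<close> by linarith
      qed
      with j show ?thesis by simp
    qed
    have "c \<in> ?Y" by (rule range_eqI[of _ _ 0]) simp
    then obtain w where "w \<in> W" using p chain_partition_obtain by metis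
    then obtain i where i: "(T ^^ i) c \<in> W" using W by auto
    have closed_mult: "(T ^^ (i + d * m)) c \<in> W" for m
    proof (induction m)
      case (Suc m)
      then show ?case using closed[of "i + d * m"] by (simp add: add_ac)
    qed (simp add: i)
    have sub: "R (i mod d) \<subseteq> W"
    proof
      fix x assume "x \<in> R (i mod d)"
      then obtain a where a: "a mod d = i mod d" "x = (T ^^ a) c" by (auto simp: R_def)
      have "i \<le> a + d * s * i" using ds by (simp add: trans_le_add2)
      moreover have "(a + d * s * i) mod d = i mod d"
        using a by (simp add: mult.assoc)
      ultimately obtain m where m: "a + d * s * i = i + d * m"
        by (metis dvd_def le_add_diff_inverse mod_eq_dvd_iff_nat)
      have "x = (T ^^ (a + d * s * i)) c" using a by (simp add: per)
      then show "x \<in> W" using closed_mult m by simp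
    qed
    moreover have "W \<subseteq> R (i mod d)"
    proof
      fix w assume w: "w \<in> W"
      \<comment> \<open>The class itself covers \<open>w\<close> by a chain starting at some
        \<open>u\<close> in the class, hence in \<open>W\<close>; uniqueness within the partition by
        \<open>W\<close> gives \<open>u = w\<close>.\<close>
      have "chain_partition d T (R (i mod d)) ?Y" using R_splits ds by simp
      moreover have "w \<in> ?Y" using w W by auto
      ultimately obtain j u where u: "j < d" "u \<in> R (i mod d)" "w = (T ^^ j) u"
        by (rule chain_partition_obtain)
      have "(T ^^ 0) w = (T ^^ j) u" using u by simp
      from chain_partition_eqD[OF p this ds(1) u(1) w] u sub show "w \<in> R (i mod d)" by auto
    qed
    ultimately show ?thesis using ds by (intro exI[of _ "i mod d"]) auto
  qed
  have "{W. chain_partition d T W ?Y} = R ` {..<d}" using R_splits eq_R by auto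
  moreover have "inj_on R {..<d}"
  proof (rule inj_onI)
    fix i j assume ij: "i \<in> {..<d}" "j \<in> {..<d}" "R i = R j"
    have "(T ^^ i) c \<in> R i" unfolding R_def using ij(1) by (intro imageI) simp
    then have "(T ^^ i) c \<in> R j" by (simp only: ij)
    then obtain k where "k mod d = j" "(T ^^ i) c = (T ^^ k) c" by (auto simp: R_def)
    then show "i = j" using cong_d[of i k] ij by simp
  qed
  moreover have "finite ?Y"
  proof -
    have "?Y \<subseteq> (\<lambda>i. (T ^^ i) c) ` {..<d * s}"
    proof
      fix x assume "x \<in> ?Y"
      then obtain i where "x = (T ^^ i) c" by auto
      then have "x = (T ^^ (i mod (d * s))) c" by (simp add: per)
      then show "x \<in> (\<lambda>i. (T ^^ i) c) ` {..<d * s}" using ds by auto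
    qed
    then show ?thesis by (rule finite_subset) auto
  qed
  ultimately show ?thesis
    using ds by (simp add: num_splitting_def splitting_subset_iff_chain_partition card_image)
qed

text \<open>Labels never increase along \<open>T\<close>, and every node both comes from
  \<open>c\<close> and returns to \<open>c\<close>, so they are constant.\<close>

lemma labelings_cycle:
  assumes Y: "Y = range (\<lambda>i. (T ^^ i) c)" and per: "\<And>x. x \<in> Y \<Longrightarrow> \<exists>i. (T ^^ i) x = c"
  shows "labelings d Y T = (\<lambda>a. \<lambda>x\<in>Y. a) ` {1..d}"
proof
  have TY: "T \<in> Y \<rightarrow> Y" unfolding Y by (auto intro: range_eqI[of _ _ "Suc _"])
  show "(\<lambda>a. \<lambda>x\<in>Y. a) ` {1..d} \<subseteq> labelings d Y T"
    using TY by (auto simp: labelings_def PiE_iff)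
  show "labelings d Y T \<subseteq> (\<lambda>a. \<lambda>x\<in>Y. a) ` {1..d}"
  proof
    fix f assume f: "f \<in> labelings d Y T"
    have c: "c \<in> Y" unfolding Y by (rule range_eqI[of _ _ 0]) simp
    have dec: "f ((T ^^ i) x) \<le> f x" if "x \<in> Y" for i x
    proof (induction i)
      case (Suc i)
      have "f (T ((T ^^ i) x)) \<le> f ((T ^^ i) x)"
        using f funpow_in[OF TY that, of i] by (simp add: labelings_def)
      with Suc show ?case by simp
    qed simp
    have "f x = f c" if x: "x \<in> Y" for x
    proof (rule antisym)
      show "f x \<le> f c" using x dec[OF c] unfolding Y by auto
      show "f c \<le> f x" using per[OF x] dec[OF x] by metis
    qed
    then have "f = (\<lambda>x\<in>Y. f c)" using f by (auto simp: labelings_def PiE_iff extensional_def)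
    moreover have "f c \<in> {1..d}" using f c by (auto simp: labelings_def PiE_iff)
    ultimately show "f \<in> (\<lambda>a. \<lambda>x\<in>Y. a) ` {1..d}" by blast
  qed
qed

lemma labelings_weight_cycle:
  fixes z :: "'b::comm_ring_1"
  assumes Y: "Y = range (\<lambda>i. (T ^^ i) c)" and per: "\<And>x. x \<in> Y \<Longrightarrow> \<exists>i. (T ^^ i) x = c"
    and z: "z ^ card Y = 1"
  shows "(\<Sum>f\<in>labelings d Y T. \<Prod>x\<in>Y. z ^ f x) = of_nat d"
proof -
  have "c \<in> Y" unfolding Y by (rule range_eqI[of _ _ 0]) simp
  then have "inj_on (\<lambda>a. \<lambda>x\<in>Y. a) {1..d}"
    by (auto intro!: inj_onI dest: fun_cong[where x = c])
  moreover have "labelings d Y T = (\<lambda>a. \<lambda>x\<in>Y. a) ` {1..d}"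
    by (rule labelings_cycle[OF Y per])
  ultimately have "(\<Sum>f\<in>labelings d Y T. \<Prod>x\<in>Y. z ^ f x) = (\<Sum>a=1..d. \<Prod>x\<in>Y. z ^ a)"
    by (simp add: sum.reindex)
  also have "\<dots> = (\<Sum>a=1..d. (z ^ card Y) ^ a)" by (simp add: power_mult[symmetric] mult.commute)
  finally show ?thesis using z by simp
qed

section \<open>Iterates and the cycle of a connected endofunction\<close>

lemma cycle_nodes_closed: "T \<in> X \<rightarrow> X \<Longrightarrow> T \<in> cycle_nodes X T \<rightarrow> cycle_nodes X T"
  by (auto simp: cycle_nodes_def funpow_swap1[symmetric])

text \<open>Two cycle nodes with periods \<open>i\<close> and \<open>j\<close> share the period
  \<open>i * j\<close>, so both are recovered from their common image by \<open>i * j - 1\<close>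
  further steps.\<close>

lemma inj_on_cycle_nodes: "inj_on T (cycle_nodes X T)"
proof (rule inj_onI)
  fix x y assume "x \<in> cycle_nodes X T" "y \<in> cycle_nodes X T" and eq: "T x = T y"
  then obtain i j where ij: "i > 0" "(T ^^ i) x = x" "j > 0" "(T ^^ j) y = y"
    by (auto simp: cycle_nodes_def)
  have "(T ^^ (i * j)) x = x" "(T ^^ (i * j)) y = y"
    using funpow_mod_eq[OF ij(2), of "i * j"] funpow_mod_eq[OF ij(4), of "i * j"] by simp_all
  moreover obtain m where "i * j = Suc m" using ij by (cases "i * j") auto
  ultimately show "x = y" using eq by (simp add: funpow_Suc_right del: funpow.simps)
qed

lemma funpow_eq_cancel:
  assumes "T \<in> K \<rightarrow> K" "inj_on T K" "x \<in> K" "y \<in> K" "(T ^^ i) x = (T ^^ i) y"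
  shows "x = y"
  using assms(5)
proof (induction i)
  case (Suc i)
  then show ?case using inj_onD[OF assms(2)] funpow_in[OF assms(1)] assms(3,4) by simp
qed simp

lemma funpow_diff: "i \<le> j \<Longrightarrow> (T ^^ (j - i)) ((T ^^ i) x) = (T ^^ j) x"
  by (metis comp_apply funpow_add le_add_diff_inverse2)

lemma reaches_cycle:
  assumes "finite X" "T \<in> X \<rightarrow> X" "x \<in> X"
  shows "\<exists>i. (T ^^ i) x \<in> cycle_nodes X T"
proof -
  have "\<not> inj (\<lambda>i. (T ^^ i) x)"
    using funpow_in[OF assms(2,3)] assms(1)
    by (metis finite_imageD finite_subset image_subsetI infinite_UNIV_nat)
  then obtain i j where "i < j" "(T ^^ i) x = (T ^^ j) x"
    unfolding inj_on_def by (metis linorder_neqE_nat)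
  then have "(T ^^ (j - i)) ((T ^^ i) x) = (T ^^ i) x"
    using funpow_diff[of i j T x] by simp
  then have "(T ^^ i) x \<in> cycle_nodes X T"
    unfolding cycle_nodes_def using \<open>i < j\<close> funpow_in[OF assms(2,3), of i] zero_less_diff by blast
  then show ?thesis ..
qed

text \<open>Along an undirected path, each edge, in either direction, costs one additional
  application of \<open>T\<close> on one of the two sides.\<close>

lemma connected_common_iterate:
  assumes "connected_endo X T" "x \<in> X" "y \<in> X"
  shows "\<exists>i j. (T ^^ i) x = (T ^^ j) y"
proof -
  have "(x, y) \<in> (functional_graph X T \<union> (functional_graph X T)\<inverse>)\<^sup>*"
    using assms by (simp add: connected_endo_def)
  then show ?thesis
  proof (induction rule: rtrancl_induct)
    case base
    show ?case by blast
  next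
    case (step y z)
    then obtain i j where ij: "(T ^^ i) x = (T ^^ j) y" by auto
    from step(2) consider "z = T y" | "y = T z" by (auto simp: functional_graph_def)
    then show ?case
    proof cases
      case 1
      have "(T ^^ Suc i) x = (T ^^ j) z" using ij 1 by (simp add: funpow_swap1)
      then show ?thesis by blast
    next
      case 2
      have "(T ^^ i) x = (T ^^ Suc j) z" using ij 2 by (simp add: funpow_swap1)
      then show ?thesis by blast
    qed
  qed
qed

text \<open>Connectedness gives any cycle node a common iterate with \<open>c\<close>, and its own
  period carries it back, so it lies on the orbit of \<open>c\<close>. The least period of
  \<open>c\<close> then equals the number of cycle nodes.\<close>

lemma cycle_nodes_parametrization:
  assumes X: "finite X" and T: "T \<in> X \<rightarrow> X" and conn: "connected_endo X T"
  obtains c where "cycle_nodes X T = range (\<lambda>i. (T ^^ i) c)"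
    and "\<And>i j. (T ^^ i) c = (T ^^ j) c \<longleftrightarrow>
      i mod card (cycle_nodes X T) = j mod card (cycle_nodes X T)"
proof -
  let ?K = "cycle_nodes X T"
  have K: "T \<in> ?K \<rightarrow> ?K" and inj: "inj_on T ?K"
    using cycle_nodes_closed[OF T] inj_on_cycle_nodes by auto
  obtain x where "x \<in> X" using conn by (auto simp: connected_endo_def)
  then obtain c where c: "c \<in> ?K" using reaches_cycle[OF X T] by blast
  define p where "p = (LEAST p. p > 0 \<and> (T ^^ p) c = c)"
  have "\<exists>p>0. (T ^^ p) c = c" using c by (auto simp: cycle_nodes_def)
  then have p: "p > 0" "(T ^^ p) c = c" unfolding p_def by (metis (mono_tags, lifting) LeastI)+
  have p_min: "(T ^^ i) c \<noteq> c" if "0 < i" "i < p" for i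
    using that not_less_Least[of i "\<lambda>p. p > 0 \<and> (T ^^ p) c = c"] by (auto simp: p_def)
  have range: "?K = range (\<lambda>i. (T ^^ i) c)"
  proof
    show "range (\<lambda>i. (T ^^ i) c) \<subseteq> ?K" using funpow_in[OF K c] by auto
    show "?K \<subseteq> range (\<lambda>i. (T ^^ i) c)"
    proof
      fix y assume y: "y \<in> ?K"
      then obtain i j where ij: "(T ^^ i) c = (T ^^ j) y"
        using connected_common_iterate[OF conn, of c y] c by (auto simp: cycle_nodes_def)
      obtain q where q: "q > 0" "(T ^^ q) y = y" using y by (auto simp: cycle_nodes_def)
      \<comment> \<open>\<open>q * j\<close> is a multiple of the period of \<open>y\<close> that is
        at least \<open>j\<close>, so the path through \<open>(T ^^ j) y\<close> can be continued
        back to \<open>y\<close>.\<close>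
      have jq: "j \<le> q * j" using q by simp
      have "y = (T ^^ (q * j)) y" using funpow_mod_eq[OF q(2), of "q * j"] by simp
      also have "\<dots> = (T ^^ (q * j - j)) ((T ^^ j) y)"
        using jq by (simp add: funpow_diff)
      also have "\<dots> = (T ^^ (q * j - j + i)) c" by (simp add: ij[symmetric] funpow_add)
      finally show "y \<in> range (\<lambda>i. (T ^^ i) c)" by auto
    qed
  qed
  have distinct: "i = j" if "i \<le> j" "j < p" "(T ^^ i) c = (T ^^ j) c" for i j
  proof -
    have "(T ^^ i) c = (T ^^ i) ((T ^^ (j - i)) c)"
      using that by (metis comp_apply funpow_add le_add_diff_inverse)
    then have "c = (T ^^ (j - i)) c"
      using funpow_eq_cancel[OF K inj c funpow_in[OF K c]] by blast
    then show ?thesis using p_min[of "j - i"] that by fastforce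
  qed
  have inj_p: "inj_on (\<lambda>i. (T ^^ i) c) {..<p}"
  proof (rule inj_onI)
    fix i j assume "i \<in> {..<p}" "j \<in> {..<p}" "(T ^^ i) c = (T ^^ j) c"
    then show "i = j" using distinct[of i j] distinct[of j i] by (cases "i \<le> j") auto
  qed
  have mod_p: "(T ^^ (i mod p)) c = (T ^^ i) c" for i by (rule funpow_mod_eq[OF p(2)])
  have "?K = (\<lambda>i. (T ^^ i) c) ` {..<p}"
  proof
    show "?K \<subseteq> (\<lambda>i. (T ^^ i) c) ` {..<p}"
    proof
      fix y assume "y \<in> ?K"
      then obtain i where "y = (T ^^ (i mod p)) c" unfolding range by (auto simp: mod_p)
      then show "y \<in> (\<lambda>i. (T ^^ i) c) ` {..<p}" using p by auto
    qed
  qed (auto simp: range)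
  then have card: "card ?K = p" using inj_p by (simp add: card_image)
  have "(T ^^ i) c = (T ^^ j) c \<longleftrightarrow> i mod p = j mod p" for i j
    using inj_onD[OF inj_p, of "i mod p" "j mod p"] p by (metis mod_p lessThan_iff mod_less_divisor)
  then show thesis using that range card by blast
qed

section \<open>The attached trees\<close>

text \<open>This makes the distance to the cycle a height function as required by
  \<open>remove_chain_partition\<close>.\<close>

lemma Least_reaches_cycle_step:
  assumes "(T ^^ i) x \<in> K" "x \<notin> K"
  shows "(LEAST i. (T ^^ i) x \<in> K) = Suc (LEAST i. (T ^^ i) (T x) \<in> K)"
  using Least_Suc[of "\<lambda>i. (T ^^ i) x \<in> K" i] assms
  by (simp add: funpow_Suc_right del: funpow.simps(2))

text \<open>The two maps differ only at the root. A chain can meet the root only in its last node,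
  since \<open>tree_endo\<close> fixes the root and the next node would repeat it.\<close>

lemma tree_endo_iterate:
  assumes p: "chain_partition d (tree_endo T v) W Y" and w: "w \<in> W" and "i < d"
  shows "(tree_endo T v ^^ i) w = (T ^^ i) w"
  using \<open>i < d\<close>
proof (induction i)
  case (Suc i)
  have "(tree_endo T v ^^ i) w \<noteq> v"
  proof
    assume "(tree_endo T v ^^ i) w = v"
    then have "(tree_endo T v ^^ Suc i) w = (tree_endo T v ^^ i) w" by (simp add: tree_endo_def)
    then show False using chain_partition_eqD[OF p _ Suc.prems _ w w, of i] Suc.prems by simp
  qed
  with Suc have ne: "(T ^^ i) w \<noteq> v"
    and "(tree_endo T v ^^ Suc i) w = tree_endo T v ((T ^^ i) w)"
    by auto
  note this(2)
  also have "tree_endo T v ((T ^^ i) w) = (T ^^ Suc i) w" using ne by (simp add: tree_endo_def)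
  finally show ?case .
qed simp

text \<open>If a path met two roots at different times, it would be on the cycle from just after the
  first one, whereas roots are off the cycle.\<close>

lemma tree_nodes_unique:
  assumes T: "T \<in> X \<rightarrow> X" and "u \<in> attached_roots X T" "v \<in> attached_roots X T"
    and "x \<in> tree_nodes X T u" "x \<in> tree_nodes X T v"
  shows "u = v"
proof -
  have "\<not> i < j" if "a \<in> attached_roots X T" "b \<in> attached_roots X T"
    "(T ^^ i) x = a" "(T ^^ j) x = b" for a b i j
  proof
    assume "i < j"
    then have "b = (T ^^ (j - Suc i)) (T a)"
      using that by (metis Suc_leI add_diff_inverse_nat comp_apply funpow.simps(2) funpow_add
          le_add_diff_inverse2 linorder_not_less)
    moreover have "T a \<in> cycle_nodes X T" using that by (simp add: attached_roots_def)
    ultimately have "b \<in> cycle_nodes X T"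
      using funpow_in[OF cycle_nodes_closed[OF T]] by simp
    then show False using that by (simp add: attached_roots_def)
  qed
  then show ?thesis
    using assms by (auto simp: tree_nodes_def) (metis linorder_neqE_nat)
qed

lemma UN_tree_nodes:
  assumes X: "finite X" and T: "T \<in> X \<rightarrow> X"
  shows "(\<Union>v\<in>attached_roots X T. tree_nodes X T v) = X - cycle_nodes X T"
proof
  show "(\<Union>v\<in>attached_roots X T. tree_nodes X T v) \<subseteq> X - cycle_nodes X T"
    using funpow_in[OF cycle_nodes_closed[OF T]] by (auto simp: tree_nodes_def attached_roots_def)
  show "X - cycle_nodes X T \<subseteq> (\<Union>v\<in>attached_roots X T. tree_nodes X T v)"
  proof
    fix x assume x: "x \<in> X - cycle_nodes X T"
    \<comment> \<open>The node just before the first entry into the cycle is the root of the tree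
      that contains \<open>x\<close>.\<close>
    define i where "i = (LEAST i. (T ^^ i) x \<in> cycle_nodes X T)"
    have i: "(T ^^ i) x \<in> cycle_nodes X T"
      unfolding i_def using reaches_cycle[OF X T] x by (metis (mono_tags, lifting) DiffD1 LeastI)
    then obtain m where m: "i = Suc m" using x by (cases i) auto
    then have "(T ^^ m) x \<notin> cycle_nodes X T"
      unfolding i_def by (metis (mono_tags, lifting) lessI not_less_Least)
    then have "(T ^^ m) x \<in> attached_roots X T"
      using i m x funpow_in[OF T, of x m] by (auto simp: attached_roots_def)
    then show "x \<in> (\<Union>v\<in>attached_roots X T. tree_nodes X T v)"
      using x by (auto simp: tree_nodes_def)
  qed
qed

text \<open>Chains in the trees are chains of \<open>T\<close>, and the trees partition the nodes
  off the cycle, so the bijections of the single trees combine into one.\<close>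

lemma chain_partition_off_cycle:
  assumes d: "d > 0" and X: "finite X" and T: "T \<in> X \<rightarrow> X"
    and trees: "\<And>v. v \<in> attached_roots X T \<Longrightarrow>
      \<exists>W. splitting_subset d (tree_nodes X T v) (tree_endo T v) W"
  shows "\<exists>W. chain_partition d T W (X - cycle_nodes X T)"
proof -
  have fin: "finite (tree_nodes X T v)" for v using X by (simp add: tree_nodes_def)
  obtain W where W: "\<And>v. v \<in> attached_roots X T \<Longrightarrow>
      chain_partition d (tree_endo T v) (W v) (tree_nodes X T v)"
    using trees d fin by (simp add: splitting_subset_iff_chain_partition) metis
  have "bij_betw (\<lambda>(i, w). (T ^^ i) w) ({..<d} \<times> W v) (tree_nodes X T v)"
    if "v \<in> attached_roots X T" for v
    using W[OF that, unfolded chain_partition_def] tree_endo_iterate[OF W[OF that]]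
    by (subst bij_betw_cong[where g = "\<lambda>(i, w). (tree_endo T v ^^ i) w"]) auto
  moreover have "disjoint_family_on (tree_nodes X T) (attached_roots X T)"
    using tree_nodes_unique[OF T] by (auto simp: disjoint_family_on_def)
  ultimately have "bij_betw (\<lambda>(i, w). (T ^^ i) w) (\<Union>v\<in>attached_roots X T. {..<d} \<times> W v)
      (\<Union>v\<in>attached_roots X T. tree_nodes X T v)"
    by (intro bij_betw_UNION_disjoint)
  moreover have "(\<Union>v\<in>attached_roots X T. {..<d} \<times> W v) = {..<d} \<times> (\<Union>v\<in>attached_roots X T. W v)"
    by auto
  ultimately show ?thesis
    unfolding chain_partition_def UN_tree_nodes[OF X T] by auto
qed

theorem theorem4p4:
  fixes d n k s :: nat and \<zeta> :: complex and T :: "nat \<Rightarrow> nat"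
  assumes "d > 0" and "n > 0" and "k > 0" and "s > 0"
    and "d dvd n"
    and "primitive_root_of_unity d \<zeta>"
    and "T \<in> {1..n} \<rightarrow> {1..n}"
    and "connected_endo {1..n} T"
    and "card (cycle_nodes {1..n} T) = d * s"
    and "card (attached_roots {1..n} T) = k"
    and "\<And>v. v \<in> attached_roots {1..n} T \<Longrightarrow>
           \<exists>W. splitting_subset d (tree_nodes {1..n} T v) (tree_endo T v) W"
  shows "of_nat (num_splitting d {1..n} T) = flag_gf d {1..n} T (\<lambda>i. \<zeta> ^ i)"
proof -
  let ?X = "{1..n}" and ?K = "cycle_nodes {1..n} T"
  have T: "T \<in> ?X \<rightarrow> ?X" by fact
  have K: "?K \<subseteq> ?X" by (auto simp: cycle_nodes_def)
  obtain W where W: "chain_partition d T W (?X - ?K)"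
    using chain_partition_off_cycle[OF \<open>d > 0\<close> _ T] assms(11) by auto
  have "finite W" using chain_partition_subset[OF W \<open>d > 0\<close>] by (rule finite_subset) simp
  have "(LEAST i. (T ^^ i) x \<in> ?K) = Suc (LEAST i. (T ^^ i) (T x) \<in> ?K)" if "x \<in> ?X - ?K" for x
    using reaches_cycle[OF _ T, of x] that Least_reaches_cycle_step by auto
  then have red: "num_splitting d ?X T = num_splitting d ?K T"
      "(\<Sum>f\<in>labelings d ?X T. \<Prod>x\<in>?X. \<zeta> ^ f x) = (\<Sum>f\<in>labelings d ?K T. \<Prod>x\<in>?K. \<zeta> ^ f x)"
    using remove_chain_partition[OF assms(6) \<open>finite W\<close> _ T K cycle_nodes_closed[OF T] W,
        of "\<lambda>x. LEAST i. (T ^^ i) x \<in> ?K"]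
    by auto
  obtain c where c: "?K = range (\<lambda>i. (T ^^ i) c)"
      and per: "\<And>i j. (T ^^ i) c = (T ^^ j) c \<longleftrightarrow> i mod (d * s) = j mod (d * s)"
    using cycle_nodes_parametrization[OF _ T assms(8)] unfolding assms(9) by auto
  have returns: "\<exists>i. (T ^^ i) x = c" if x: "x \<in> ?K" for x
  proof -
    obtain j where j: "x = (T ^^ j) c" using x unfolding c by auto
    \<comment> \<open>The \<open>j\<close> steps from \<open>c\<close> to \<open>x\<close> are
      completed to \<open>j\<close> full turns of the cycle.\<close>
    have "(T ^^ (d * s * j - j + j)) c = (T ^^ 0) c"
      unfolding per using assms(1,4) by simp
    then have "(T ^^ (d * s * j - j)) x = c" using j by (simp add: funpow_add)
    then show ?thesis by blast
  qed
  have root: "\<zeta> ^ card ?K = 1"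
    unfolding assms(9) using assms(6) by (simp add: primitive_root_of_unity_def power_mult)
  have "(\<Sum>f\<in>labelings d ?K T. \<Prod>x\<in>?K. \<zeta> ^ f x) = of_nat d"
    by (rule labelings_weight_cycle[OF c returns root])
  moreover have "num_splitting d ?K T = d"
    unfolding c using num_splitting_cycle[OF assms(1,4) per] .
  ultimately show ?thesis
    using red flag_gf_eq_sum_labelings[OF _ T, of d "\<lambda>i. \<zeta> ^ i"] by simp
qed

end
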